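(* Let $L\ge2$ be an integer and $R\ge0$. For any discrete memoryless channel $W_{\mathbf{y}|\mathbf{x}}$ with input alphabet $\mathcal{X}$ and output alphabet $\mathcal{Y}$, there exists a sequence of codes $\mathcal{C}_n\subset\mathcal{X}^n$ of increasing blocklengths $n$, each of rate at least $R$, satisfying $$\liminf_{n\to\infty}\left[-\frac1n\log P_{\mathrm{e},\mathrm{avg},L-1}(\mathcal{C}_n)\right]\ge E_{\mathrm{ex},L-1}(R),$$ where $$E_{\mathrm{ex},L-1}(R)=\max_{P_{\mathbf{x}}\in\Delta(\mathcal{X})}\ \max_{\rho\ge1}\left\{-(L-1)\rho R+E_{\mathrm{x},L-1}(\rho,P_{\mathbf{x}})\right\},$$ $$E_{\mathrm{x},L-1}(\rho,P_{\mathbf{x}})=-\rho\log\left[\sum_{(x_0,\dots,x_{L-1})\in\mathcal{X}^L}\left(\prod_{k=0}^{L-1}P_{\mathbf{x}}(x_k)\right)\left(\sum_{y\in\mathcal{Y}}\prod_{i=0}^{L-1}W_{\mathbf{y}|\mathbf{x}}(y|x_i)^{1/L}\right)^{1/\rho}\right].$$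
   Context: $\log$ is to base $2$; $\Delta(\mathcal{X})$ is the set of probability distributions on $\mathcal{X}$; a maximum that is not attained is read as a supremum. A discrete memoryless channel (DMC) is given by discrete alphabets $\mathcal{X},\mathcal{Y}$ and conditional probabilities $W_{\mathbf{y}|\mathbf{x}}(y|x)$; input $x\in\mathcal{X}^n$ produces output $y\in\mathcal{Y}^n$ with probability $\prod_{j=1}^nW_{\mathbf{y}|\mathbf{x}}(y(j)|x(j))$. A code of blocklength $n$ is a codebook $\mathcal{C}=\{x_i\}_{i=1}^M$ of $M$ indexed codewords in $\mathcal{X}^n$ (repetitions allowed), of rate $\frac1n\log M$, equipped with an $(L-1)$-list-decoder assigning to each $y\in\mathcal{Y}^n$ a set of $L-1$ indices in $\{1,\dots,M\}$. $P_{\mathrm{e},L-1}(i,\mathcal{C})$ is the probability that, when $x_i$ is sent, the decoder's output list does not contain $i$, and $P_{\mathrm{e},\mathrm{avg},L-1}(\mathcal{C})=\frac1M\sum_{i=1}^MP_{\mathrm{e},L-1}(i,\mathcal{C})$. *)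

theory Defs
  imports "HOL-Probability.Probability"
begin

text \<open>
  A discrete memoryless channel is a family \<open>W :: 'x \<Rightarrow> 'y pmf\<close>, so that \<open>pmf (W x) y\<close> is the
  conditional probability of \<open>y\<close> given \<open>x\<close>. Alphabets are types of class \<open>countable\<close>
  (finite alphabets included). Words of length \<open>n\<close> are functions on the positions \<open>{..<n}\<close>,
  extended by \<open>undefined\<close>.
\<close>

definition words :: "nat \<Rightarrow> (nat \<Rightarrow> 'a) set" where
  "words n = {..<n} \<rightarrow>\<^sub>E UNIV"

definition block_channel :: "('x::countable \<Rightarrow> 'y::countable pmf) \<Rightarrow> nat \<Rightarrow> (nat \<Rightarrow> 'x) \<Rightarrow> (nat \<Rightarrow> 'y) pmf" where
  "block_channel W n x = Pi_pmf {..<n} undefined (\<lambda>j. W (x j))"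

lemma pmf_block_channel:
  assumes "y \<in> words n"
  shows "pmf (block_channel W n x) y = (\<Prod>j<n. pmf (W (x j)) (y j))"
  using assms unfolding block_channel_def words_def
  by (subst pmf_Pi') (auto simp: PiE_def extensional_def)

record ('x, 'y) code =
  size_of :: nat
  codeword :: "nat \<Rightarrow> nat \<Rightarrow> 'x"
  decoder :: "(nat \<Rightarrow> 'y) \<Rightarrow> nat set"

definition is_list_code :: "nat \<Rightarrow> nat \<Rightarrow> ('x, 'y) code \<Rightarrow> bool" where
  "is_list_code l n C \<longleftrightarrow>
     size_of C \<ge> 1 \<and>
     (\<forall>i\<in>{1..size_of C}. codeword C i \<in> words n) \<and>
     (\<forall>y\<in>words n. decoder C y \<subseteq> {1..size_of C} \<and> card (decoder C y) = l)"

definition rate :: "nat \<Rightarrow> ('x, 'y) code \<Rightarrow> real" where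
  "rate n C = 1 / real n * log 2 (real (size_of C))"

definition error_prob :: "('x::countable \<Rightarrow> 'y::countable pmf) \<Rightarrow> nat \<Rightarrow> ('x, 'y) code \<Rightarrow> nat \<Rightarrow> real" where
  "error_prob W n C i =
     measure_pmf.prob (block_channel W n (codeword C i)) {y. i \<notin> decoder C y}"

definition avg_error_prob :: "('x::countable \<Rightarrow> 'y::countable pmf) \<Rightarrow> nat \<Rightarrow> ('x, 'y) code \<Rightarrow> real" where
  "avg_error_prob W n C =
     1 / real (size_of C) * (\<Sum>i=1..size_of C. error_prob W n C i)"

text \<open>The library has \<open>log 2 0 = 0\<close>; a vanishing error probability must have exponent \<open>\<infinity>\<close>.\<close>

definition elog2 :: "real \<Rightarrow> ereal" where
  "elog2 p = (if p = 0 then - \<infinity> else ereal (log 2 p))"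

definition overlap :: "('x::countable \<Rightarrow> 'y::countable pmf) \<Rightarrow> nat \<Rightarrow> (nat \<Rightarrow> 'x) \<Rightarrow> real" where
  "overlap W L x = (\<Sum>\<^sub>\<infinity>y. \<Prod>i<L. pmf (W (x i)) y powr (1 / real L))"

definition E_x_sum :: "('x::countable \<Rightarrow> 'y::countable pmf) \<Rightarrow> nat \<Rightarrow> real \<Rightarrow> 'x pmf \<Rightarrow> real" where
  "E_x_sum W L \<rho> P =
     (\<Sum>\<^sub>\<infinity>x\<in>words L. (\<Prod>k<L. pmf P (x k)) * overlap W L x powr (1 / \<rho>))"

definition E_x :: "('x::countable \<Rightarrow> 'y::countable pmf) \<Rightarrow> nat \<Rightarrow> real \<Rightarrow> 'x pmf \<Rightarrow> real" where
  "E_x W L \<rho> P = - \<rho> * log 2 (E_x_sum W L \<rho> P)"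

definition E_ex :: "('x::countable \<Rightarrow> 'y::countable pmf) \<Rightarrow> nat \<Rightarrow> real \<Rightarrow> ereal" where
  "E_ex W L R =
     (SUP P. SUP \<rho>\<in>{1..}. ereal (- real (L - 1) * \<rho> * R + E_x W L \<rho> P))"

text \<open>
  For infinite alphabets the sums above are genuine: they converge, and the argument of the
  logarithm is positive, so no default value of \<open>infsum\<close> or \<open>log\<close> is involved.
\<close>

lemma pmf_summable_on: "pmf p summable_on A"
  using pmf_abs_summable[of p A] abs_summable_equivalent abs_summable_summable by blast

lemma sum_pmf_summable_on: "(\<lambda>y. \<Sum>i<(n::nat). pmf (p i) y) summable_on A"
  by (induction n) (auto intro!: summable_on_add pmf_summable_on)

lemma overlap_term_le:
  assumes "L \<ge> 1"
  shows "(\<Prod>i<L. pmf (W (x i)) y powr (1 / real L)) \<le> (\<Sum>i<L. pmf (W (x i)) y)"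
proof -
  let ?s = "\<Sum>i<L. pmf (W (x i)) y"
  have s: "?s \<ge> 0" by (intro sum_nonneg) auto
  have "(\<Prod>i<L. pmf (W (x i)) y powr (1 / real L)) \<le> (\<Prod>i<L. ?s powr (1 / real L))"
    by (intro prod_mono conjI powr_mono2 member_le_sum) auto
  also have "\<dots> = (?s powr (1 / real L)) ^ L" by simp
  also have "\<dots> = ?s"
  proof (cases "?s = 0")
    case True
    then show ?thesis using assms by (simp add: zero_power)
  next
    case False
    then have "?s > 0" using s by linarith
    then have "(?s powr (1 / real L)) ^ L = ?s powr (real L * (1 / real L))"
      by (subst powr_realpow[symmetric]) (auto simp: powr_powr)
    then show ?thesis using assms \<open>?s > 0\<close> by simp
  qed
  finally show ?thesis .
qed

lemma overlap_summable:
  fixes W :: "'x::countable \<Rightarrow> 'y::countable pmf"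
  assumes "L \<ge> 1"
  shows "(\<lambda>y. \<Prod>i<L. pmf (W (x i)) y powr (1 / real L)) summable_on UNIV"
  by (rule summable_on_comparison_test[where f = "\<lambda>y. \<Sum>i<L. pmf (W (x i)) y"])
     (auto intro!: sum_pmf_summable_on overlap_term_le assms prod_nonneg)

lemma overlap_nonneg: "overlap W L x \<ge> 0"
  unfolding overlap_def by (intro infsum_nonneg prod_nonneg) auto

lemma infsum_pmf: "infsum (pmf p) UNIV = 1"
proof -
  have "infsetsum (pmf p) UNIV = infsum (pmf p) UNIV"
    using pmf_abs_summable[of p UNIV] by (rule infsetsum_infsum)
  then show ?thesis by (simp add: infsetsum_pmf_eq_1)
qed

lemma infsum_sum_pmf: "(\<Sum>\<^sub>\<infinity>y. \<Sum>i<n. pmf (p i) y) = real n"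
  by (induction n) (simp_all add: infsum_add sum_pmf_summable_on pmf_summable_on infsum_pmf)

lemma overlap_le:
  fixes W :: "'x::countable \<Rightarrow> 'y::countable pmf"
  assumes "L \<ge> 1"
  shows "overlap W L x \<le> real L"
proof -
  have "overlap W L x \<le> (\<Sum>\<^sub>\<infinity>y. \<Sum>i<L. pmf (W (x i)) y)"
    unfolding overlap_def
    by (intro infsum_mono overlap_summable sum_pmf_summable_on overlap_term_le assms)
  then show ?thesis by (simp add: infsum_sum_pmf)
qed

lemma E_x_sum_summable:
  fixes W :: "'x::countable \<Rightarrow> 'y::countable pmf"
  assumes "L \<ge> 1" "\<rho> \<ge> 1"
  shows "(\<lambda>x. (\<Prod>k<L. pmf P (x k)) * overlap W L x powr (1 / \<rho>)) summable_on words L"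
proof (rule summable_on_comparison_test)
  have "(\<lambda>x. pmf (Pi_pmf {..<L} undefined (\<lambda>_. P)) x * real L powr (1 / \<rho>)) summable_on words L"
    by (intro summable_on_cmult_left pmf_summable_on)
  then show "(\<lambda>x. (\<Prod>k<L. pmf P (x k)) * real L powr (1 / \<rho>)) summable_on words L"
    by (rule summable_on_cong[THEN iffD1, rotated])
       (subst pmf_Pi', auto simp: words_def PiE_def extensional_def)
next
  fix x assume "x \<in> (words L :: (nat \<Rightarrow> 'x) set)"
  show "(\<Prod>k<L. pmf P (x k)) * overlap W L x powr (1 / \<rho>)
          \<le> (\<Prod>k<L. pmf P (x k)) * real L powr (1 / \<rho>)"
    using assms
    by (intro mult_left_mono powr_mono2 overlap_le overlap_nonneg prod_nonneg) auto
qed (auto intro!: prod_nonneg mult_nonneg_nonneg)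

lemma E_x_sum_pos:
  fixes W :: "'x::countable \<Rightarrow> 'y::countable pmf"
  assumes "L \<ge> 1" "\<rho> \<ge> 1"
  shows "E_x_sum W L \<rho> P > 0"
proof -
  obtain a where a: "a \<in> set_pmf P" using set_pmf_not_empty[of P] by blast
  define z where "z = (\<lambda>k\<in>{..<L}. a)"
  have z: "z \<in> words L" by (auto simp: z_def words_def)
  have "overlap W L z = (\<Sum>\<^sub>\<infinity>y. pmf (W a) y)"
    unfolding overlap_def
  proof (rule infsum_cong)
    fix y
    have "(\<Prod>i<L. pmf (W (z i)) y powr (1 / real L)) = (pmf (W a) y powr (1 / real L)) ^ L"
      by (simp add: z_def)
    also have "\<dots> = pmf (W a) y"
    proof (cases "pmf (W a) y = 0")
      case True
      then show ?thesis using assms by (simp add: zero_power)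
    next
      case False
      then have p: "pmf (W a) y > 0" using pmf_nonneg[of "W a" y] by linarith
      then have "(pmf (W a) y powr (1 / real L)) ^ L = pmf (W a) y powr (real L * (1 / real L))"
        by (subst powr_realpow[symmetric]) (auto simp: powr_powr)
      then show ?thesis using assms p by simp
    qed
    finally show "(\<Prod>i<L. pmf (W (z i)) y powr (1 / real L)) = pmf (W a) y" .
  qed
  then have ov: "overlap W L z = 1" by (simp add: infsum_pmf)
  have "0 < pmf P a ^ L" using a by (simp add: pmf_positive)
  also have "\<dots> = (\<Sum>\<^sub>\<infinity>x\<in>{z}. (\<Prod>k<L. pmf P (x k)) * overlap W L x powr (1 / \<rho>))"
    by (simp add: ov) (simp add: z_def)
  also have "\<dots> \<le> E_x_sum W L \<rho> P"
    unfolding E_x_sum_def using z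
    by (intro infsum_mono_neutral E_x_sum_summable assms)
       (auto intro!: mult_nonneg_nonneg prod_nonneg)
  finally show ?thesis .
qed

end

theory Submission
  imports Defs
begin

text \<open>
  The proof is random coding with expurgation, for a list decoder. A maximum likelihood list
  decoder fails on message \<open>i\<close> only if \<open>L - 1\<close> other messages are at least as likely, so the error
  probability of \<open>i\<close> is at most the sum, over all \<open>L\<close>-sets of messages containing \<open>i\<close>, of the overlap
  of their \<open>L\<close> output distributions (\<open>list_decoding_bound\<close>). The overlap of codewords is the product
  of the overlaps of their letters (\<open>bhattacharyya_block_channel\<close>).

  Draw \<open>2 * M\<close> codewords with independent letters of law \<open>P\<close>. The \<open>1 / \<rho>\<close>-th power of the overlap of
  \<open>L\<close> of them has expectation \<open>A ^ n\<close>, where \<open>A\<close> is the sum inside the logarithm of the exponent, so in some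
  codebook these powers add up to at most \<open>(2 * M) ^ L * A ^ n\<close> (\<open>random_codebook\<close>). By Markov's
  inequality half of the codewords see at most a share of order \<open>1 / M\<close> of that total
  (\<open>expurgation\<close>). Keeping only those and raising to the power \<open>\<rho>\<close>, which by
  \<open>sum_le_powr_sum_powr\<close> can be moved outside the sum, bounds every error probability by
  \<open>(K * M ^ (L - 1) * A ^ n) powr \<rho>\<close> with a constant \<open>K\<close> (\<open>exists_good_code\<close>). With \<open>M\<close> of order
  \<open>2 powr (n * R)\<close> the exponent of this bound is \<open>- (L - 1) * \<rho> * R + E_x W L \<rho> P\<close>.

  The bound holds for all \<open>P\<close> and \<open>\<rho>\<close>, while the sizes \<open>M\<close> do not depend on them. A sequence
  of codes which are optimal for their size, up to a superexponentially small error, therefore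
  attains all these exponents simultaneously, and hence their supremum.
\<close>

section \<open>Bhattacharyya coefficients of several distributions\<close>

text \<open>
  This is the overlap of the distributions \<open>q t\<close>, \<open>t \<in> T\<close>, which is the classical Bhattacharyya
  coefficient when \<open>T\<close> has two elements. Indexing by a set rather than by \<open>{..<L}\<close> makes it
  symmetric by construction and lets it be summed over subsets of messages without ordering them;
  leaving the outcome type arbitrary lets it apply to single letters and to whole blocks alike.
\<close>

definition bhattacharyya :: "('i \<Rightarrow> 'a pmf) \<Rightarrow> 'i set \<Rightarrow> real" where
  "bhattacharyya q T = (\<Sum>\<^sub>\<infinity>y. \<Prod>t\<in>T. pmf (q t) y powr (1 / real (card T)))"

text \<open>
  Comparison with the sum is cruder than the inequality between the means, but it already gives
  convergence and boundedness of the coefficient, and its size disappears in the exponent.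
\<close>

lemma geometric_mean_le_sum:
  fixes a :: "'i \<Rightarrow> real"
  assumes "finite T" "T \<noteq> {}" and a: "\<And>t. t \<in> T \<Longrightarrow> a t \<ge> 0"
  shows "(\<Prod>t\<in>T. a t powr (1 / real (card T))) \<le> (\<Sum>t\<in>T. a t)"
proof -
  let ?s = "\<Sum>t\<in>T. a t"
  have s: "?s \<ge> 0" by (intro sum_nonneg a)
  have c: "card T > 0" using assms by (simp add: card_gt_0_iff)
  have "(\<Prod>t\<in>T. a t powr (1 / real (card T))) \<le> (\<Prod>t\<in>T. ?s powr (1 / real (card T)))"
    using assms by (intro prod_mono conjI powr_mono2 member_le_sum) auto
  also have "\<dots> = (?s powr (1 / real (card T))) powr real (card T)"
    using c by (simp add: powr_realpow')
  also have "\<dots> = ?s"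
    using s c by (simp add: powr_powr)
  finally show ?thesis .
qed

lemma summable_on_sum_finite:
  fixes f :: "'i \<Rightarrow> 'a \<Rightarrow> real"
  assumes "finite I" "\<And>i. i \<in> I \<Longrightarrow> f i summable_on A"
  shows "(\<lambda>y. \<Sum>i\<in>I. f i y) summable_on A"
  using assms by (induction I rule: finite_induct) (auto intro!: summable_on_add)

lemma infsum_sum_finite:
  fixes f :: "'i \<Rightarrow> 'a \<Rightarrow> real"
  assumes "finite I" "\<And>i. i \<in> I \<Longrightarrow> f i summable_on A"
  shows "(\<Sum>\<^sub>\<infinity>y\<in>A. \<Sum>i\<in>I. f i y) = (\<Sum>i\<in>I. infsum (f i) A)"
  using assms
  by (induction I rule: finite_induct) (auto simp: infsum_add summable_on_sum_finite)

lemma bhattacharyya_summable: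
  assumes "finite T" "T \<noteq> {}"
  shows "(\<lambda>y. \<Prod>t\<in>T. pmf (q t) y powr (1 / real (card T))) summable_on A"
proof (rule summable_on_comparison_test)
  show "(\<lambda>y. \<Sum>t\<in>T. pmf (q t) y) summable_on A"
    by (intro summable_on_sum_finite pmf_summable_on assms)
  show "(\<Prod>t\<in>T. pmf (q t) y powr (1 / real (card T))) \<le> (\<Sum>t\<in>T. pmf (q t) y)" for y
    by (intro geometric_mean_le_sum assms) simp
qed (simp add: prod_nonneg)

lemma bhattacharyya_nonneg: "bhattacharyya q T \<ge> 0"
  unfolding bhattacharyya_def by (intro infsum_nonneg prod_nonneg) auto

lemma bhattacharyya_le_card:
  assumes "finite T" "T \<noteq> {}"
  shows "bhattacharyya q T \<le> real (card T)"
proof -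
  have "bhattacharyya q T \<le> (\<Sum>\<^sub>\<infinity>y. \<Sum>t\<in>T. pmf (q t) y)"
    unfolding bhattacharyya_def using assms
    by (intro infsum_mono bhattacharyya_summable summable_on_sum_finite pmf_summable_on
              geometric_mean_le_sum) auto
  also have "\<dots> = real (card T)"
    using assms by (simp add: infsum_sum_finite pmf_summable_on infsum_pmf)
  finally show ?thesis .
qed

lemma bhattacharyya_reindex:
  assumes "inj_on f T"
  shows "bhattacharyya q (f ` T) = bhattacharyya (\<lambda>t. q (f t)) T"
  using assms by (simp add: bhattacharyya_def prod.reindex card_image)

lemma overlap_eq_bhattacharyya: "overlap W L x = bhattacharyya (\<lambda>i. W (x i)) {..<L}"
  by (simp add: overlap_def bhattacharyya_def)

text \<open>
  Memorylessness: a sum over words of a product over positions is a product of sums over letters.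
  This makes every estimate below exponential in the blocklength.
\<close>

lemma bhattacharyya_block_channel:
  fixes W :: "'x::countable \<Rightarrow> 'y::countable pmf"
  assumes "finite T" "T \<noteq> {}"
  shows "bhattacharyya (\<lambda>t. block_channel W n (x t)) T
           = (\<Prod>j<n. bhattacharyya (\<lambda>t. W (x t j)) T)"
proof -
  let ?s = "1 / real (card T)"
  have "bhattacharyya (\<lambda>t. block_channel W n (x t)) T
      = (\<Sum>\<^sub>\<infinity>y\<in>words n. \<Prod>j<n. \<Prod>t\<in>T. pmf (W (x t j)) (y j) powr ?s)"
    unfolding bhattacharyya_def
  proof (rule infsum_cong_neutral)
    fix y :: "nat \<Rightarrow> 'y" assume "y \<in> UNIV - words n"
    then have "\<exists>j. j \<notin> {..<n} \<and> y j \<noteq> undefined"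
      by (auto simp: words_def PiE_def extensional_def)
    then have "pmf (block_channel W n (x t)) y = 0" for t
      unfolding block_channel_def by (intro pmf_Pi_outside) auto
    then show "(\<Prod>t\<in>T. pmf (block_channel W n (x t)) y powr ?s) = 0"
      using assms by auto
  next
    fix y :: "nat \<Rightarrow> 'y" assume "y \<in> UNIV \<inter> words n"
    then have "(\<Prod>t\<in>T. pmf (block_channel W n (x t)) y powr ?s)
        = (\<Prod>t\<in>T. \<Prod>j<n. pmf (W (x t j)) (y j) powr ?s)"
      by (simp add: pmf_block_channel prod_powr_distrib)
    also have "\<dots> = (\<Prod>j<n. \<Prod>t\<in>T. pmf (W (x t j)) (y j) powr ?s)"
      by (rule prod.swap)
    finally show "(\<Prod>t\<in>T. pmf (block_channel W n (x t)) y powr ?s) = \<dots>" .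
  qed auto
  also have "\<dots> = (\<Prod>j<n. \<Sum>\<^sub>\<infinity>y. \<Prod>t\<in>T. pmf (W (x t j)) y powr ?s)"
    unfolding words_def using bhattacharyya_summable[OF assms]
    by (intro infsum_prod_PiE_abs) (auto simp: abs_prod)
  finally show ?thesis by (simp add: bhattacharyya_def)
qed

section \<open>Maximum likelihood list decoding\<close>

text \<open>
  Adding a maximiser of the remaining elements one at a time produces the list of the \<open>l\<close> best
  elements, whichever way ties are broken.
\<close>

lemma ex_top_subset:
  fixes f :: "'i \<Rightarrow> real"
  assumes "finite I" "l \<le> card I"
  shows "\<exists>D\<subseteq>I. card D = l \<and> (\<forall>i\<in>I - D. \<forall>j\<in>D. f i \<le> f j)"
  using assms(2)
proof (induction l)
  case 0
  then show ?case by (intro exI[of _ "{}"]) auto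
next
  case (Suc l)
  then have "\<exists>D\<subseteq>I. card D = l \<and> (\<forall>i\<in>I - D. \<forall>j\<in>D. f i \<le> f j)" by simp
  then obtain D where D: "D \<subseteq> I" "card D = l" "\<And>i j. i \<in> I - D \<Longrightarrow> j \<in> D \<Longrightarrow> f i \<le> f j"
    by blast
  have "I - D \<noteq> {}"
  proof
    assume "I - D = {}"
    then have "I = D" using D(1) by blast
    then show False using D(2) Suc.prems by simp
  qed
  then have "Max (f ` (I - D)) \<in> f ` (I - D)" using assms(1) by (intro Max_in) auto
  then obtain m where m: "m \<in> I - D" "Max (f ` (I - D)) = f m" by auto
  have m': "f i \<le> f m" if "i \<in> I - D" for i
    unfolding m(2)[symmetric] using that assms(1) by (intro Max_ge) auto
  have "finite D" using D assms(1) finite_subset by blast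
  then have "card (insert m D) = Suc l" "insert m D \<subseteq> I" using D m(1) by auto
  moreover have "\<forall>i\<in>I - insert m D. \<forall>j\<in>insert m D. f i \<le> f j" using D(3) m' by blast
  ultimately show ?case by blast
qed

text \<open>
  The decoder lists the \<open>l\<close> most likely messages. If \<open>i\<close> is missing from the list at output \<open>y\<close>,
  then all \<open>l\<close> listed messages are at least as likely as \<open>i\<close>, so the probability of \<open>y\<close> under
  \<open>i\<close> is at most the geometric mean of the likelihoods over \<open>i\<close> and the list. The list depends on
  \<open>y\<close>; summing over all sets of \<open>Suc l\<close> messages containing \<open>i\<close> removes this dependence.
\<close>

lemma list_decoding_bound:
  fixes q :: "'i \<Rightarrow> 'a pmf"
  assumes "finite I" "l \<le> card I"
  obtains D where "\<And>y. D y \<subseteq> I" "\<And>y. card (D y) = l"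
    "\<And>i. i \<in> I \<Longrightarrow> measure_pmf.prob (q i) {y. i \<notin> D y}
        \<le> (\<Sum>T | T \<subseteq> I \<and> card T = Suc l \<and> i \<in> T. bhattacharyya q T)"
proof -
  have "\<forall>y. \<exists>D. D \<subseteq> I \<and> card D = l \<and> (\<forall>i\<in>I - D. \<forall>j\<in>D. pmf (q i) y \<le> pmf (q j) y)"
    by (intro allI ex_top_subset assms)
  from choice[OF this] obtain D where D: "\<And>y. D y \<subseteq> I" "\<And>y. card (D y) = l"
      "\<And>y i j. i \<in> I - D y \<Longrightarrow> j \<in> D y \<Longrightarrow> pmf (q i) y \<le> pmf (q j) y"
    by blast
  have "measure_pmf.prob (q i) {y. i \<notin> D y}
        \<le> (\<Sum>T | T \<subseteq> I \<and> card T = Suc l \<and> i \<in> T. bhattacharyya q T)" if i: "i \<in> I" for i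
  proof -
    let ?TT = "{T. T \<subseteq> I \<and> card T = Suc l \<and> i \<in> T}"
    let ?g = "\<lambda>T y. \<Prod>t\<in>T. pmf (q t) y powr (1 / real (card T))"
    have fin: "finite ?TT" using assms(1) by simp
    have finT: "finite T" "T \<noteq> {}" if "T \<in> ?TT" for T
      using that assms(1) finite_subset by auto
    have sm: "?g T summable_on A" if "T \<in> ?TT" for T A
      by (intro bhattacharyya_summable finT[OF that])
    have le: "pmf (q i) y \<le> (\<Sum>T\<in>?TT. ?g T y)" if y: "i \<notin> D y" for y
    proof -
      let ?T = "insert i (D y)"
      have fD: "finite (D y)" using D(1) assms(1) finite_subset by blast
      have T: "?T \<in> ?TT" using D(1,2) i y fD by auto
      have "pmf (q i) y = (pmf (q i) y powr (1 / real (Suc l))) powr real (Suc l)"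
        by (simp add: powr_powr)
      also have "\<dots> = (pmf (q i) y powr (1 / real (Suc l))) ^ Suc l"
        by (rule powr_realpow') auto
      also have "\<dots> = (\<Prod>t\<in>?T. pmf (q i) y powr (1 / real (Suc l)))"
        using T by (simp only: prod_constant mem_Collect_eq)
      also have "\<dots> \<le> (\<Prod>t\<in>?T. pmf (q t) y powr (1 / real (Suc l)))"
        using D(3)[of i y] i y by (intro prod_mono conjI powr_mono2) auto
      also have "\<dots> = ?g ?T y" using T by simp
      also have "\<dots> \<le> (\<Sum>T\<in>?TT. ?g T y)"
        by (rule member_le_sum[OF T _ fin]) (auto intro!: prod_nonneg)
      finally show ?thesis .
    qed
    have "measure_pmf.prob (q i) {y. i \<notin> D y} = infsum (pmf (q i)) {y. i \<notin> D y}"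
      by (simp add: measure_pmf_conv_infsetsum infsetsum_infsum pmf_abs_summable)
    also have "\<dots> \<le> (\<Sum>\<^sub>\<infinity>y. \<Sum>T\<in>?TT. ?g T y)"
      using le by (intro infsum_mono_neutral pmf_summable_on summable_on_sum_finite fin sm)
                  (auto intro!: sum_nonneg prod_nonneg)
    also have "\<dots> = (\<Sum>T\<in>?TT. bhattacharyya q T)"
      unfolding bhattacharyya_def by (intro infsum_sum_finite fin sm)
    finally show ?thesis .
  qed
  then show thesis by (rule that[OF D(1,2)])
qed

section \<open>Expurgation and random coding\<close>

text \<open>
  Every set is counted by its \<open>L\<close> members, so the weights seen by single indices add up to
  \<open>L\<close> times the total weight. By Markov's inequality fewer than \<open>M\<close> of the \<open>2 * M\<close> indices see
  more than \<open>L / M\<close> times the total; they are discarded. Removing indices only removes sets, so the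
  bound survives when the code is restricted to the remaining ones.
\<close>

lemma expurgation:
  fixes w :: "'i set \<Rightarrow> real"
  assumes "finite J" "card J = 2 * M" "M \<ge> 1" and w: "\<And>T. w T \<ge> 0"
  shows "\<exists>I\<subseteq>J. card I = M \<and> (\<forall>i\<in>I. (\<Sum>T | T \<subseteq> J \<and> card T = L \<and> i \<in> T. w T)
            \<le> real L / real M * (\<Sum>T | T \<subseteq> J \<and> card T = L. w T))"
proof -
  let ?TT = "{T. T \<subseteq> J \<and> card T = L}"
  let ?X = "\<Sum>T\<in>?TT. w T"
  define s where "s = (\<lambda>i. \<Sum>T | T \<subseteq> J \<and> card T = L \<and> i \<in> T. w T)"
  have s: "s i = (\<Sum>T | T \<in> ?TT \<and> i \<in> T. w T)" for i
    unfolding s_def by (intro sum.cong) auto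
  have s0: "s i \<ge> 0" for i unfolding s_def by (intro sum_nonneg w)
  have "(\<Sum>i\<in>J. s i) = (\<Sum>T\<in>?TT. \<Sum>i | i \<in> J \<and> i \<in> T. w T)"
    unfolding s using assms(1) by (intro sum.swap_restrict) auto
  also have "\<dots> = (\<Sum>T\<in>?TT. real L * w T)"
  proof (rule sum.cong)
    fix T assume "T \<in> ?TT"
    then have "{i \<in> J. i \<in> T} = T" "card T = L" by auto
    then show "(\<Sum>i | i \<in> J \<and> i \<in> T. w T) = real L * w T" by simp
  qed simp
  also have "\<dots> = real L * ?X" by (simp add: sum_distrib_left)
  finally have tot: "(\<Sum>i\<in>J. s i) = real L * ?X" .
  let ?b = "real L / real M * ?X"
  let ?bad = "{i \<in> J. ?b < s i}"
  have b0: "?b \<ge> 0" by (intro mult_nonneg_nonneg sum_nonneg w) auto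
  have "card ?bad < M"
  proof (rule ccontr)
    assume c: "\<not> card ?bad < M"
    have "real L * ?X = real M * ?b" using assms(3) by simp
    also have "\<dots> \<le> real (card ?bad) * ?b" using c by (intro mult_right_mono b0) auto
    also have "\<dots> = (\<Sum>i\<in>?bad. ?b)" by simp
    also have "\<dots> < (\<Sum>i\<in>?bad. s i)"
    proof (rule sum_strict_mono)
      show "?bad \<noteq> {}"
      proof
        assume "?bad = {}"
        then have "card ?bad = 0" by (simp only: card.empty)
        then show False using c assms(3) by linarith
      qed
    qed (use assms(1) in auto)
    also have "\<dots> \<le> (\<Sum>i\<in>J. s i)" using assms(1) s0 by (intro sum_mono2) auto
    finally show False using tot by simp
  qed
  then have "card (J - ?bad) \<ge> M"
    using assms(1,2) by (subst card_Diff_subset) auto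
  then obtain I where "I \<subseteq> J - ?bad" "card I = M"
    by (rule obtain_subset_with_card_n)
  then show ?thesis by (intro exI[of _ I]) (auto simp: s_def not_less)
qed

text \<open>
  Subadditivity of the power \<open>1 / \<rho>\<close>: it lets a random coding average of powers \<open>1 / \<rho>\<close>, which is
  less dominated by rare bad codewords, control the error probability itself.
\<close>

lemma sum_le_powr_sum_powr:
  fixes b :: "'i \<Rightarrow> real"
  assumes "finite A" "\<rho> \<ge> 1" and b: "\<And>i. i \<in> A \<Longrightarrow> b i \<ge> 0"
  shows "(\<Sum>i\<in>A. b i) \<le> (\<Sum>i\<in>A. b i powr (1 / \<rho>)) powr \<rho>"
proof -
  let ?V = "\<Sum>i\<in>A. b i powr (1 / \<rho>)"
  have V: "?V \<ge> 0" by (intro sum_nonneg) auto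
  have split: "v powr \<rho> = v * v powr (\<rho> - 1)" if "v \<ge> 0" for v :: real
    using that by (cases "v = 0") (auto simp: powr_diff)
  have "(\<Sum>i\<in>A. b i) = (\<Sum>i\<in>A. (b i powr (1 / \<rho>)) powr \<rho>)"
    using assms by (intro sum.cong) (auto simp: powr_powr)
  also have "\<dots> = (\<Sum>i\<in>A. b i powr (1 / \<rho>) * (b i powr (1 / \<rho>)) powr (\<rho> - 1))"
    by (intro sum.cong split) auto
  also have "\<dots> \<le> (\<Sum>i\<in>A. b i powr (1 / \<rho>) * ?V powr (\<rho> - 1))"
    using assms by (intro sum_mono mult_left_mono powr_mono2 member_le_sum) auto
  also have "\<dots> = ?V powr \<rho>" using split[OF V] by (simp add: sum_distrib_right)
  finally show ?thesis .
qed

lemma expectation_pmf_infsum: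
  fixes f :: "'a \<Rightarrow> real"
  assumes "\<And>x. \<bar>f x\<bar> \<le> B"
  shows "measure_pmf.expectation p f = (\<Sum>\<^sub>\<infinity>x. pmf p x * f x)"
proof -
  have "(\<lambda>x. norm (pmf p x * f x)) summable_on UNIV"
  proof (rule summable_on_comparison_test)
    show "(\<lambda>x. pmf p x * B) summable_on UNIV"
      by (intro summable_on_cmult_left pmf_summable_on)
  qed (use assms in \<open>auto simp: abs_mult intro!: mult_left_mono\<close>)
  from infsetsum_infsum[OF abs_summable_equivalent[THEN iffD1, OF this]] show ?thesis
    by (simp add: pmf_expectation_eq_infsetsum)
qed

text \<open>
  All random variables below are bounded, so that integrability is never an issue.
\<close>

lemma bhattacharyya_powr_bounded:
  assumes "finite T" "T \<noteq> {}" "\<rho> > 0"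
  shows "\<bar>bhattacharyya q T powr (1 / \<rho>)\<bar> \<le> real (card T) powr (1 / \<rho>)"
  using assms by (auto intro!: powr_mono2 bhattacharyya_le_card bhattacharyya_nonneg)

text \<open>
  The letters which the messages in \<open>T\<close> use at one fixed position are \<open>L\<close> independent draws
  from \<open>P\<close>; averaging their overlap over the draws is the sum inside the logarithm of the exponent.
  The proof discards the messages outside \<open>T\<close> and numbers those inside.
\<close>

lemma expectation_column:
  fixes W :: "'x::countable \<Rightarrow> 'y::countable pmf" and J :: "nat set"
  assumes "finite J" "T \<subseteq> J" "card T = L" "L \<ge> 1" "\<rho> \<ge> 1"
  shows "measure_pmf.expectation (Pi_pmf J undefined (\<lambda>_. P))
           (\<lambda>c. bhattacharyya (\<lambda>t. W (c t)) T powr (1 / \<rho>)) = E_x_sum W L \<rho> P"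
proof -
  have T: "finite T" "T \<noteq> {}" using assms finite_subset by auto
  let ?F = "\<lambda>c. bhattacharyya (\<lambda>t. W (c t)) T powr (1 / \<rho>)"
  let ?G = "\<lambda>x. overlap W L x powr (1 / \<rho>)"
  obtain e where e: "bij_betw e {..<L} T"
    using ex_bij_betw_nat_finite[OF T(1)] assms(3) by (auto simp: atLeast0LessThan)
  obtain z where z: "z \<notin> T" using ex_new_if_finite[OF infinite_UNIV_nat T(1)] by blast
  \<comment> \<open>Extending \<open>e\<close> by a value outside \<open>T\<close> makes composition with it send functions that are
    undefined off \<open>T\<close> to functions that are undefined off \<open>{..<L}\<close>.\<close>
  define h where "h = (\<lambda>k. if k < L then e k else z)"
  have h: "bij_betw h {..<L} T"
    using e by (rule bij_betw_cong[THEN iffD1, rotated]) (auto simp: h_def)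
  have cong: "bhattacharyya (\<lambda>t. W (c t)) T = bhattacharyya (\<lambda>t. W (c' t)) T"
    if "\<And>t. t \<in> T \<Longrightarrow> c t = c' t" for c c' :: "nat \<Rightarrow> 'x"
    unfolding bhattacharyya_def using that by (intro infsum_cong prod.cong) auto
  have FG: "?F g = ?G (g \<circ> h)" for g
  proof -
    have "bhattacharyya (\<lambda>t. W (g t)) (h ` {..<L}) = bhattacharyya (\<lambda>k. W (g (h k))) {..<L}"
      by (rule bhattacharyya_reindex) (use h in \<open>simp add: bij_betw_def\<close>)
    then show ?thesis using h by (simp add: bij_betw_def overlap_eq_bhattacharyya)
  qed
  have "measure_pmf.expectation (Pi_pmf J undefined (\<lambda>_. P)) ?F
      = measure_pmf.expectation (Pi_pmf T undefined (\<lambda>_. P)) ?F"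
    unfolding Pi_pmf_subset[OF assms(1,2)] integral_map_pmf
    by (intro Bochner_Integration.integral_cong refl arg_cong[where f = "\<lambda>v. v powr _"] cong) auto
  also have "\<dots> = measure_pmf.expectation (Pi_pmf {..<L} undefined (\<lambda>_. P)) ?G"
    by (subst Pi_pmf_bij_betw[OF _ h]) (auto simp: FG h_def z)
  also have "\<dots> = (\<Sum>\<^sub>\<infinity>x. pmf (Pi_pmf {..<L} undefined (\<lambda>_. P)) x * ?G x)"
    unfolding overlap_eq_bhattacharyya
    by (rule expectation_pmf_infsum, rule bhattacharyya_powr_bounded)
       (use assms in \<open>auto simp: lessThan_empty_iff\<close>)
  also have "\<dots> = E_x_sum W L \<rho> P"
    unfolding E_x_sum_def
  proof (rule infsum_cong_neutral)
    fix x :: "nat \<Rightarrow> 'x" assume "x \<in> UNIV - words L"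
    then show "pmf (Pi_pmf {..<L} undefined (\<lambda>_. P)) x * ?G x = 0"
      by (subst pmf_Pi_outside) (auto simp: words_def PiE_def extensional_def)
  next
    fix x :: "nat \<Rightarrow> 'x" assume "x \<in> UNIV \<inter> words L"
    then show "pmf (Pi_pmf {..<L} undefined (\<lambda>_. P)) x * ?G x = (\<Prod>k<L. pmf P (x k)) * ?G x"
      by (subst pmf_Pi') (auto simp: words_def PiE_def extensional_def)
  qed simp
  finally show ?thesis .
qed

text \<open>
  The codebook is drawn column by column: \<open>c j t\<close> is the letter of message \<open>t\<close> at position \<open>j\<close>,
  all letters being independent. The overlap of a set of codewords is then a product of functions
  of independent columns, so its expectation factorises, and some codebook is no worse than average.
\<close>

lemma random_codebook:
  fixes W :: "'x::countable \<Rightarrow> 'y::countable pmf" and J :: "nat set"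
  assumes "finite J" "L \<ge> 1" "\<rho> \<ge> 1"
  shows "\<exists>c :: nat \<Rightarrow> nat \<Rightarrow> 'x.
    (\<Sum>T | T \<subseteq> J \<and> card T = L. (\<Prod>j<n. bhattacharyya (\<lambda>t. W (c j t)) T) powr (1 / \<rho>))
      \<le> real (card J choose L) * E_x_sum W L \<rho> P ^ n"
proof -
  let ?TT = "{T. T \<subseteq> J \<and> card T = L}"
  let ?Q = "Pi_pmf {..<n} undefined (\<lambda>_. Pi_pmf J undefined (\<lambda>_. P)) :: (nat \<Rightarrow> nat \<Rightarrow> 'x) pmf"
  let ?f = "\<lambda>T c. bhattacharyya (\<lambda>t. W (c t)) T powr (1 / \<rho>)"
  let ?F = "\<lambda>c. \<Sum>T\<in>?TT. \<Prod>j<n. ?f T (c j)"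
  have T: "finite T" "T \<noteq> {}" if "T \<in> ?TT" for T
    using that assms finite_subset by auto
  have bnd: "\<bar>?f T c\<bar> \<le> real L powr (1 / \<rho>)" if "T \<in> ?TT" for T and c :: "nat \<Rightarrow> 'x"
    using bhattacharyya_powr_bounded[OF T[OF that], of \<rho>] that assms by auto
  have int: "integrable (measure_pmf ?Q) (\<lambda>c. \<Prod>j<n. ?f T (c j))" if "T \<in> ?TT" for T
  proof (rule measure_pmf.integrable_const_bound[where B = "(real L powr (1 / \<rho>)) ^ n"])
    have "norm (\<Prod>j<n. ?f T (c j)) \<le> (real L powr (1 / \<rho>)) ^ n" for c :: "nat \<Rightarrow> nat \<Rightarrow> 'x"
    proof -
      have "norm (\<Prod>j<n. ?f T (c j)) = (\<Prod>j<n. \<bar>?f T (c j)\<bar>)" by (simp add: abs_prod)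
      also have "\<dots> \<le> (\<Prod>j<n. real L powr (1 / \<rho>))"
        by (intro prod_mono conjI abs_ge_zero bnd that)
      finally show ?thesis by simp
    qed
    then show "AE c in measure_pmf ?Q. norm (\<Prod>j<n. ?f T (c j)) \<le> (real L powr (1 / \<rho>)) ^ n"
      by simp
  qed simp
  have "measure_pmf.expectation ?Q ?F
      = (\<Sum>T\<in>?TT. measure_pmf.expectation ?Q (\<lambda>c. \<Prod>j<n. ?f T (c j)))"
    by (intro Bochner_Integration.integral_sum int)
  also have "\<dots> = (\<Sum>T\<in>?TT. E_x_sum W L \<rho> P ^ n)"
  proof (rule sum.cong)
    fix T assume TT: "T \<in> ?TT"
    have "measure_pmf.expectation ?Q (\<lambda>c. \<Prod>j<n. ?f T (c j))
        = (\<Prod>j<n. measure_pmf.expectation (Pi_pmf J undefined (\<lambda>_. P)) (?f T))"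
      by (intro expectation_prod_Pi_pmf measure_pmf.integrable_const_bound[where B = "real L powr (1 / \<rho>)"])
         (use bnd[OF TT] in auto)
    also have "\<dots> = E_x_sum W L \<rho> P ^ n"
      using expectation_column[OF assms(1), of T L \<rho> P W] TT assms by simp
    finally show "measure_pmf.expectation ?Q (\<lambda>c. \<Prod>j<n. ?f T (c j)) = E_x_sum W L \<rho> P ^ n" .
  qed simp
  also have "\<dots> = real (card J choose L) * E_x_sum W L \<rho> P ^ n"
    using n_subsets[OF assms(1)] by simp
  finally have E: "measure_pmf.expectation ?Q ?F = real (card J choose L) * E_x_sum W L \<rho> P ^ n" .
  have "\<exists>c. ?F c \<le> measure_pmf.expectation ?Q ?F"
  proof (rule ccontr)
    assume "\<not> (\<exists>c. ?F c \<le> measure_pmf.expectation ?Q ?F)"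
    then have "AE c in measure_pmf ?Q. measure_pmf.expectation ?Q ?F < ?F c"
      by (simp add: not_le)
    then have "measure_pmf.expectation ?Q ?F < measure_pmf.expectation ?Q ?F"
      by (intro measure_pmf.expectation_greater Bochner_Integration.integrable_sum int)
    then show False by simp
  qed
  then obtain c where c: "?F c \<le> real (card J choose L) * E_x_sum W L \<rho> P ^ n"
    unfolding E by blast
  have "(\<Prod>j<n. bhattacharyya (\<lambda>t. W (c j t)) T) powr (1 / \<rho>) = (\<Prod>j<n. ?f T (c j))" for T
    by (intro prod_powr_distrib bhattacharyya_nonneg)
  then show ?thesis using c by (intro exI[of _ c]) simp
qed

text \<open>
  Twice as many codewords as needed are drawn and a bad half is expurgated. Raising the
  bound on the sum of powers \<open>1 / \<rho>\<close> to the power \<open>\<rho>\<close> only after expurgation matters: the total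
  of the weights is larger than that of a typical index by a factor of order \<open>M\<close>, which would
  otherwise enter as \<open>M powr \<rho>\<close>.
\<close>

lemma exists_good_code:
  fixes W :: "'x::countable \<Rightarrow> 'y::countable pmf"
  assumes L: "L \<ge> 2" and \<rho>: "\<rho> \<ge> 1" and M: "M \<ge> L"
  shows "\<exists>C :: ('x, 'y) code. is_list_code (L - 1) n C \<and> size_of C = M \<and>
     avg_error_prob W n C
       \<le> (real L * 2 ^ L * real M ^ (L - 1) * E_x_sum W L \<rho> P ^ n) powr \<rho>"
proof -
  let ?A = "E_x_sum W L \<rho> P"
  define J where "J = {..<2 * M}"
  have J: "finite J" "card J = 2 * M" by (simp_all add: J_def)
  have M1: "M \<ge> 1" using L M by simp
  obtain c :: "nat \<Rightarrow> nat \<Rightarrow> 'x" where c: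
    "(\<Sum>T | T \<subseteq> J \<and> card T = L. (\<Prod>j<n. bhattacharyya (\<lambda>t. W (c j t)) T) powr (1 / \<rho>))
      \<le> real (card J choose L) * ?A ^ n"
    using random_codebook[where W = W and P = P and n = n, OF J(1), of L \<rho>] L \<rho> by auto
  define w where "w = (\<lambda>T. (\<Prod>j<n. bhattacharyya (\<lambda>t. W (c j t)) T) powr (1 / \<rho>))"
  have w0: "w T \<ge> 0" for T by (simp add: w_def)
  obtain I where I: "I \<subseteq> J" "card I = M"
    "\<And>i. i \<in> I \<Longrightarrow> (\<Sum>T | T \<subseteq> J \<and> card T = L \<and> i \<in> T. w T)
            \<le> real L / real M * (\<Sum>T | T \<subseteq> J \<and> card T = L. w T)"
    using expurgation[OF J M1, of w L] w0 by blast
  have finI: "finite I" using I(1) J(1) finite_subset by blast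
  obtain f where f: "bij_betw f {1..M} I"
    using ex_bij_betw_nat_finite_1[OF finI] I(2) by auto
  define x where "x = (\<lambda>i. \<lambda>j\<in>{..<n}. c j (f i))"
  let ?q = "\<lambda>i. block_channel W n (x i)"
  let ?B = "real L * 2 ^ L * real M ^ (L - 1) * ?A ^ n"
  have A0: "?A \<ge> 0" using E_x_sum_pos[of L \<rho> W P] L \<rho> by simp
  have SucL: "Suc (L - 1) = L" using L by simp
  have list_fits: "finite {1..M}" "L - 1 \<le> card {1..M}" using M by simp_all
  obtain D where D: "\<And>y. D y \<subseteq> {1..M}" "\<And>y. card (D y) = L - 1"
    "\<And>i. i \<in> {1..M} \<Longrightarrow> measure_pmf.prob (?q i) {y. i \<notin> D y}
        \<le> (\<Sum>T | T \<subseteq> {1..M} \<and> card T = Suc (L - 1) \<and> i \<in> T. bhattacharyya ?q T)"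
    by (rule list_decoding_bound[OF list_fits, of ?q]) (rule that)
  define C :: "('x, 'y) code" where "C = \<lparr>size_of = M, codeword = x, decoder = D\<rparr>"
  have code: "is_list_code (L - 1) n C"
    using M1 D(1,2) by (auto simp: is_list_code_def C_def x_def words_def)
  have X: "real L / real M * (\<Sum>T | T \<subseteq> J \<and> card T = L. w T) \<le> ?B"
  proof -
    have "(\<Sum>T | T \<subseteq> J \<and> card T = L. w T) \<le> real (card J choose L) * ?A ^ n"
      using c by (simp add: w_def)
    also have "\<dots> \<le> real ((2 * M) ^ L) * ?A ^ n"
      using M A0 binomial_le_pow[of L "2 * M"] unfolding J
      by (intro mult_right_mono of_nat_mono zero_le_power) auto
    finally have "real L / real M * (\<Sum>T | T \<subseteq> J \<and> card T = L. w T)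
        \<le> real L / real M * (real ((2 * M) ^ L) * ?A ^ n)"
      by (intro mult_left_mono) auto
    also have "real ((2 * M) ^ L) = 2 ^ L * (real M * real M ^ (L - 1))"
      unfolding power_Suc[symmetric] SucL by (simp add: power_mult_distrib)
    also have "real L / real M * (2 ^ L * (real M * real M ^ (L - 1)) * ?A ^ n) = ?B"
      using M1 by simp
    finally show ?thesis .
  qed
  have err: "error_prob W n C i \<le> ?B powr \<rho>" if i: "i \<in> {1..M}" for i
  proof -
    let ?TT = "{T. T \<subseteq> {1..M} \<and> card T = L \<and> i \<in> T}"
    have fin: "finite ?TT" by simp
    have bw: "bhattacharyya ?q T powr (1 / \<rho>) = w (f ` T)" if T: "T \<in> ?TT" for T
    proof -
      have inj: "inj_on f T" using f T by (auto simp: bij_betw_def intro: inj_on_subset)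
      have T': "finite T" "T \<noteq> {}" using T finite_subset by auto
      have "bhattacharyya ?q T = (\<Prod>j<n. bhattacharyya (\<lambda>t. W (x t j)) T)"
        by (rule bhattacharyya_block_channel[OF T'])
      also have "\<dots> = (\<Prod>j<n. bhattacharyya (\<lambda>t. W (c j t)) (f ` T))"
        by (intro prod.cong) (auto simp: x_def bhattacharyya_reindex[OF inj])
      finally show ?thesis by (simp add: w_def)
    qed
    have inj: "inj_on ((`) f) ?TT"
      using f by (intro inj_on_subset[OF inj_on_image_Pow[of f "{1..M}"]]) (auto simp: bij_betw_def)
    have img: "(`) f ` ?TT \<subseteq> {T. T \<subseteq> J \<and> card T = L \<and> f i \<in> T}"
    proof safe
      fix T t assume "T \<subseteq> {1..M}" "t \<in> T"
      then show "f t \<in> J" using f I(1) by (auto simp: bij_betw_def)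
    next
      fix T assume "T \<subseteq> {1..M}"
      then show "card (f ` T) = card T"
        using f by (intro card_image) (auto simp: bij_betw_def intro: inj_on_subset)
    qed auto
    have "error_prob W n C i \<le> (\<Sum>T\<in>?TT. bhattacharyya ?q T)"
      using D(3)[OF i] unfolding SucL by (simp add: error_prob_def C_def)
    also have "\<dots> \<le> (\<Sum>T\<in>?TT. bhattacharyya ?q T powr (1 / \<rho>)) powr \<rho>"
      by (intro sum_le_powr_sum_powr fin \<rho> bhattacharyya_nonneg)
    also have "(\<Sum>T\<in>?TT. bhattacharyya ?q T powr (1 / \<rho>)) = (\<Sum>T\<in>?TT. w (f ` T))"
      by (intro sum.cong refl bw)
    also have "\<dots> = (\<Sum>T\<in>(`) f ` ?TT. w T)"
      using inj by (simp add: sum.reindex)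
    also have "\<dots> powr \<rho> \<le> ?B powr \<rho>"
    proof (rule powr_mono2)
      have "(\<Sum>T\<in>(`) f ` ?TT. w T) \<le> (\<Sum>T | T \<subseteq> J \<and> card T = L \<and> f i \<in> T. w T)"
        using J(1) w0 img by (intro sum_mono2) auto
      also have "\<dots> \<le> real L / real M * (\<Sum>T | T \<subseteq> J \<and> card T = L. w T)"
        using f i by (intro I(3)) (auto simp: bij_betw_def)
      also have "\<dots> \<le> ?B" by (rule X)
      finally show "(\<Sum>T\<in>(`) f ` ?TT. w T) \<le> ?B" .
    qed (use \<rho> w0 in \<open>auto intro!: sum_nonneg\<close>)
    finally show ?thesis .
  qed
  have "avg_error_prob W n C = 1 / real M * (\<Sum>i=1..M. error_prob W n C i)"
    by (simp add: avg_error_prob_def C_def)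
  also have "\<dots> \<le> 1 / real M * (\<Sum>i=1..M. ?B powr \<rho>)"
    by (intro mult_left_mono sum_mono err) auto
  also have "\<dots> = ?B powr \<rho>" using M1 by simp
  finally show ?thesis using code by (intro exI[of _ C]) (simp add: C_def)
qed

section \<open>Error exponents\<close>

text \<open>
  Neither a constant factor nor a superexponentially small additive term changes the exponent.
\<close>

lemma exponent_le_liminf:
  fixes p :: "nat \<Rightarrow> real"
  assumes K: "K > 0" and p0: "\<And>n. p n \<ge> 0"
    and p: "\<And>n. n \<ge> 1 \<Longrightarrow> p n \<le> K * 2 powr (- real n * E) + 2 powr (- (real n)\<^sup>2)"
  shows "ereal E \<le> liminf (\<lambda>n. ereal (- 1 / real n) * elog2 (p n))"
proof -
  let ?g = "\<lambda>n. E - log 2 (2 * K) / real n"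
  have "?g \<longlonglongrightarrow> E - 0"
    by (intro tendsto_intros lim_const_over_n)
  then have lim: "(\<lambda>n. ereal (?g n)) \<longlonglongrightarrow> ereal E" by (simp add: lim_ereal)
  have "eventually (\<lambda>n. real n \<ge> max 1 (\<bar>E\<bar> + \<bar>log 2 K\<bar>)) sequentially"
    using filterlim_real_sequentially by (simp only: filterlim_at_top)
  then have "eventually (\<lambda>n. ereal (?g n) \<le> ereal (- 1 / real n) * elog2 (p n)) sequentially"
  proof eventually_elim
    case (elim n)
    then have n: "real n \<ge> 1" "real n \<ge> \<bar>E\<bar> + \<bar>log 2 K\<bar>" by auto
    have "real n * E - log 2 K \<le> real n * \<bar>E\<bar> + real n * \<bar>log 2 K\<bar>"
    proof -
      have "real n * E \<le> real n * \<bar>E\<bar>" by (intro mult_left_mono) auto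
      moreover have "1 * \<bar>log 2 K\<bar> \<le> real n * \<bar>log 2 K\<bar>" using n by (intro mult_right_mono) auto
      ultimately show ?thesis by linarith
    qed
    also have "\<dots> \<le> (real n)\<^sup>2"
      using mult_left_mono[OF n(2), of "real n"] by (simp add: power2_eq_square distrib_left)
    finally have "2 powr (- (real n)\<^sup>2) \<le> 2 powr (log 2 K + - real n * E)"
      by (intro powr_mono) auto
    also have "\<dots> = K * 2 powr (- real n * E)"
      using K unfolding powr_add by simp
    finally have "p n \<le> 2 * K * 2 powr (- real n * E)"
      using p[of n] n by simp
    show ?case
    proof (cases "p n = 0")
      case True
      then show ?thesis using n by (simp add: elog2_def)
    next
      case False
      then have pos: "p n > 0" using p0[of n] by simp
      have "log 2 (p n) \<le> log 2 (2 * K * 2 powr (- real n * E))"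
        using pos K \<open>p n \<le> _\<close> by simp
      also have "\<dots> = log 2 (2 * K) - real n * E"
        using K by (simp add: log_mult)
      finally have "(real n * E - log 2 (2 * K)) / real n \<le> - log 2 (p n) / real n"
        using n by (intro divide_right_mono) auto
      moreover have "(real n * E - log 2 (2 * K)) / real n = ?g n"
        using n by (simp add: diff_divide_distrib)
      ultimately show ?thesis using False by (simp add: elog2_def)
    qed
  qed
  from Liminf_mono[OF this] show ?thesis
    using lim_imp_Liminf[OF sequentially_bot lim] by simp
qed

lemma avg_error_prob_nonneg: "avg_error_prob W n C \<ge> 0"
  unfolding avg_error_prob_def error_prob_def by (intro mult_nonneg_nonneg sum_nonneg) auto

theorem mainTheorem9:
  fixes W :: "'x::countable \<Rightarrow> 'y::countable pmf" and L :: nat and R :: real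
  assumes "L \<ge> 2" and "R \<ge> 0"
  shows "\<exists>C :: nat \<Rightarrow> ('x, 'y) code.
    (\<forall>n\<ge>1. is_list_code (L - 1) n (C n) \<and> rate n (C n) \<ge> R) \<and>
    liminf (\<lambda>n. ereal (- 1 / real n) * elog2 (avg_error_prob W n (C n))) \<ge> E_ex W L R"
proof -
  \<comment> \<open>The summand \<open>L\<close> makes room for a list of \<open>L - 1\<close> messages at small rates, at the cost of a
    constant factor.\<close>
  define M where "M = (\<lambda>n::nat. nat \<lceil>2 powr (real n * R)\<rceil> + L)"
  have M: "2 powr (real n * R) \<le> real (M n)" "real (M n) \<le> (2 + real L) * 2 powr (real n * R)"
    "M n \<ge> L" for n
  proof -
    let ?t = "2 powr (real n * R)"
    have t: "?t \<ge> 1" using assms(2) by (intro ge_one_powr_ge_zero) auto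
    have up: "real (nat \<lceil>?t\<rceil>) \<ge> ?t" "real (nat \<lceil>?t\<rceil>) \<le> ?t + 1"
      using t by linarith+
    show "?t \<le> real (M n)" using up(1) unfolding M_def by linarith
    have "real (M n) \<le> ?t + 1 + real L" using up(2) unfolding M_def by linarith
    also have "\<dots> \<le> ?t + ?t + real L * ?t"
      using t mult_left_mono[OF t, of "real L"] by simp
    finally show "real (M n) \<le> (2 + real L) * ?t" by (simp add: algebra_simps)
    show "M n \<ge> L" by (simp add: M_def)
  qed
  \<comment> \<open>The optimal \<open>P\<close> and \<open>\<rho>\<close> need not exist, and a sequence of codes must serve all of them at
    once. So the codes are chosen nearly optimal among all codes of the given size, with a
    superexponentially small slack since the infimum need not be attained or may vanish.\<close>
  define errs where
    "errs = (\<lambda>n. avg_error_prob W n ` {C :: ('x, 'y) code. is_list_code (L - 1) n C \<and> size_of C = M n})"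
  have bdd: "bdd_below (errs n)" for n
    unfolding errs_def by (intro bdd_belowI[of _ 0]) (auto intro: avg_error_prob_nonneg)
  have ne: "errs n \<noteq> {}" for n
    \<comment> \<open>Any input distribution will do here.\<close>
    using exists_good_code[OF assms(1), of 1 "M n" n W undefined] M(3) unfolding errs_def by blast
  have "\<exists>C :: ('x, 'y) code. is_list_code (L - 1) n C \<and> size_of C = M n \<and>
      avg_error_prob W n C \<le> Inf (errs n) + 2 powr (- (real n)\<^sup>2)" for n
  proof -
    have "Inf (errs n) < Inf (errs n) + 2 powr (- (real n)\<^sup>2)" by simp
    then obtain e where "e \<in> errs n" "e < Inf (errs n) + 2 powr (- (real n)\<^sup>2)"
      using cInf_less_iff[OF ne bdd] by blast
    then show ?thesis unfolding errs_def by (auto intro: less_imp_le)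
  qed
  then obtain C :: "nat \<Rightarrow> ('x, 'y) code" where C:
    "\<And>n. is_list_code (L - 1) n (C n)" "\<And>n. size_of (C n) = M n"
    "\<And>n. avg_error_prob W n (C n) \<le> Inf (errs n) + 2 powr (- (real n)\<^sup>2)"
    by metis
  have rate: "rate n (C n) \<ge> R" if "n \<ge> 1" for n
  proof -
    have "real n * R = log 2 (2 powr (real n * R))" by simp
    also have "\<dots> \<le> log 2 (real (M n))"
      using M(1)[of n] order_less_le_trans[OF _ M(1)[of n], of 0]
      by (subst log_le_cancel_iff) auto
    finally show ?thesis using that C(2)[of n] by (simp add: rate_def field_simps)
  qed
  have "ereal (- real (L - 1) * \<rho> * R + E_x W L \<rho> P)
      \<le> liminf (\<lambda>n. ereal (- 1 / real n) * elog2 (avg_error_prob W n (C n)))"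
    if \<rho>: "\<rho> \<ge> 1" for P \<rho>
  proof -
    let ?A = "E_x_sum W L \<rho> P" and ?E = "- real (L - 1) * \<rho> * R + E_x W L \<rho> P"
    let ?K0 = "real L * 2 ^ L * (2 + real L) ^ (L - 1)"
    have A: "?A > 0" using E_x_sum_pos[of L \<rho> W P] assms \<rho> by simp
    show ?thesis
    proof (rule exponent_le_liminf)
      show "?K0 powr \<rho> > 0" using assms by simp
      show "avg_error_prob W n (C n) \<ge> 0" for n by (rule avg_error_prob_nonneg)
      show "avg_error_prob W n (C n)
          \<le> ?K0 powr \<rho> * 2 powr (- real n * ?E) + 2 powr (- (real n)\<^sup>2)" for n
      proof -
        obtain C' :: "('x, 'y) code" where C': "is_list_code (L - 1) n C'" "size_of C' = M n"
          "avg_error_prob W n C'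
             \<le> (real L * 2 ^ L * real (M n) ^ (L - 1) * ?A ^ n) powr \<rho>"
          using exists_good_code[OF assms(1) \<rho>, of "M n" n W P] M(3) by blast
        have "Inf (errs n) \<le> avg_error_prob W n C'"
          using C'(1,2) bdd by (intro cInf_lower) (auto simp: errs_def)
        also note C'(3)
        also have "(real L * 2 ^ L * real (M n) ^ (L - 1) * ?A ^ n) powr \<rho>
            \<le> (real L * 2 ^ L * ((2 + real L) * 2 powr (real n * R)) ^ (L - 1) * ?A ^ n) powr \<rho>"
          using \<rho> A M(2)[of n]
          by (intro powr_mono2 mult_right_mono mult_left_mono power_mono) auto
        also have "\<dots> = (?K0 * ((2 powr (real n * R)) ^ (L - 1) * ?A ^ n)) powr \<rho>"
          by (simp add: power_mult_distrib mult_ac)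
        also have "\<dots> = ?K0 powr \<rho> * ((2 powr (real n * R)) ^ (L - 1) * ?A ^ n) powr \<rho>"
          using A by (intro powr_mult)
        also have "(2 powr (real n * R)) ^ (L - 1) * ?A ^ n
            = 2 powr (real n * R * real (L - 1) + log 2 ?A * real n)"
        proof -
          have "(2 powr (real n * R)) ^ (L - 1) = 2 powr (real n * R * real (L - 1))"
            by (subst powr_realpow[symmetric]) (simp_all add: powr_powr)
          moreover have "?A ^ n = (2 powr log 2 ?A) ^ n" using A by simp
          then have "?A ^ n = 2 powr (log 2 ?A * real n)"
            by (subst (asm) powr_realpow[symmetric]) (simp_all add: powr_powr)
          ultimately show ?thesis by (simp add: powr_add)
        qed
        also have "\<dots> powr \<rho> = 2 powr (- real n * ?E)"
          unfolding powr_powr E_x_def by (rule arg_cong[where f = "(powr) 2"]) algebra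
        finally show ?thesis using C(3)[of n] by linarith
      qed
    qed
  qed
  then have "E_ex W L R \<le> liminf (\<lambda>n. ereal (- 1 / real n) * elog2 (avg_error_prob W n (C n)))"
    unfolding E_ex_def by (intro SUP_least) auto
  then show ?thesis using C(1) rate by (intro exI[of _ C]) auto
qed

end
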